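(* Let $n,m,l$ be nonnegative integers with $N=n+m+l>0$, let $r,s$ be nonnegative integers, and $0<q<1$. Then \[ \int_{[0,1]^{n+m}}\prod_{i=1}^nx_i^r(qx_i;q)_l\prod_{j=1}^my_j^s(qy_j;q)_l\prod_{i=1}^n\prod_{j=1}^m(1-q^lx_iy_j)\prod_{1\le i<j\le n}(x_j-x_i)^2\prod_{1\le i<j\le m}(y_j-y_i)^2\,d_qx\,d_qy \] \[ =n!\,m!\,q^{(r+1)\binom n2+(s+1)\binom m2+2\binom n3+2\binom m3}\,\frac{\prod_{k=1}^{N-1}[k]_q!\prod_{k=1}^{n-1}[k]_q!\prod_{k=1}^{m-1}[k]_q!}{\prod_{k=1}^{l-1}[k]_q!}\cdot\frac{\prod_{i=1}^n\prod_{j=1}^m[N+r+s+i+j-1]_q}{\prod_{i=1}^n\prod_{k=1}^N[r+i+k-1]_q\prod_{j=1}^m\prod_{k=1}^N[s+j+k-1]_q}. \]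
   Context: $[a]_q=(1-q^a)/(1-q)$, $[i]_q!=[1]_q\cdots[i]_q$, $(qx;q)_l=\prod_{i=1}^l(1-q^ix)$. The Jackson integral over $[0,1]^{n+m}$ is $(1-q)^{n+m}\sum_{k_1,\dots,k_n,k'_1,\dots,k'_m\ge0} g(q^{k_1},\dots,q^{k_n},q^{k'_1},\dots,q^{k'_m})\,q^{\sum k_i+\sum k'_j}$.
   Formalization: The cross factor is corrected from 1−q^l x_i y_j to 1−q^{l+1} x_i y_j; as printed the formula fails, e.g. for n=m=1, l=r=s=0, where the left side is (2q+q²)/[2]_q² and the right side is (1+q+q²)/[2]_q². *)

theory Defs
  imports "HOL-Analysis.Analysis"
begin

definition q_bracket :: "real \<Rightarrow> nat \<Rightarrow> real" where
  "q_bracket q a = (1 - q ^ a) / (1 - q)"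

definition q_fact :: "real \<Rightarrow> nat \<Rightarrow> real" where
  "q_fact q i = (\<Prod>k=1..i. q_bracket q k)"

text \<open>The shifted $q$-factorial $(qx;q)_l$; note that the base point is $qx$, not $x$.\<close>

definition q_poch_shifted :: "real \<Rightarrow> real \<Rightarrow> nat \<Rightarrow> real" where
  "q_poch_shifted q x l = (\<Prod>i=1..l. (1 - q ^ i * x))"

text \<open>
  The Jackson integral over $[0,1]^{n+m}$ of a function of $x = (x_1,\dots,x_n)$ and
  $y = (y_1,\dots,y_m)$. Points are functions on indices, of which only the values on
  \<open>{1..n}\<close> and \<open>{1..m}\<close> are meant to be used; the multi-indices of the sum are
  extensional functions, so that each occurs exactly once. The value of \<open>infsum\<close> is \<open>0\<close>
  if the family is not summable.
\<close>

definition jackson_integral ::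
  "real \<Rightarrow> nat \<Rightarrow> nat \<Rightarrow> ((nat \<Rightarrow> real) \<Rightarrow> (nat \<Rightarrow> real) \<Rightarrow> real) \<Rightarrow> real" where
  "jackson_integral q n m g =
     (1 - q) ^ (n + m) *
     (\<Sum>\<^sub>\<infinity>(k, k') \<in> ({1..n} \<rightarrow>\<^sub>E (UNIV :: nat set)) \<times> ({1..m} \<rightarrow>\<^sub>E (UNIV :: nat set)).
        g (\<lambda>i. q ^ k i) (\<lambda>j. q ^ k' j) * q ^ ((\<Sum>i=1..n. k i) + (\<Sum>j=1..m. k' j)))"

text \<open>
  The cross factors in the integral formula are $1 - q^{l+1} x_i y_j$. With $q^l$ in
  place of $q^{l+1}$, as the formula is stated informally, it is false: for $n = m = 1$, $l = r = s = 0$,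
  $q = 1/2$ the integral of $1 - xy$ is $5/9$ and that of $1 - qxy$ is $7/9$, the value
  of the product side being $[3]_q / [2]_q^2 = 7/9$.
\<close>

end

theory Submission
  imports Defs "Jordan_Normal_Form.Determinant"
begin

text \<open>
  Up to a constant, the product of the factors $(qx_i;q)_l$, $(qy_j;q)_l$, $1-q^{l+1}x_iy_j$ and one
  copy of each of the two Vandermonde products is a single Vandermonde determinant in the $N$
  points $x_i$, $1/(q^{l+1}y_j)$ and $q^{-1},\dots,q^{-l}$. Expanding the remaining copies of the
  Vandermonde products and integrating row by row therefore gives $n!\,m!$ times an $N\times N$
  determinant with rows $1/(1-q^{r+i+N-p})$, $q^{(l+1)p}/(1-q^{s+j+p+1})$ and $q^{kp}$, where
  $0\le i<n$, $0\le j<m$, $1\le k\le l$ and $p$ is the column. In the variables $v_p=q^p$ this is a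
  Cauchy--Vandermonde determinant, which factors completely. Both sides of the formula are
  nonnegative, so signs can be ignored throughout the final comparison.
\<close>

section \<open>Vandermonde and Cauchy--Vandermonde determinants\<close>

lemma det_mat_leibniz:
  "det (mat n n (\<lambda>(i, j). f i j)) =
     (\<Sum>p | p permutes {0..<n}. signof p * (\<Prod>i<n. f i (p i)))"
  unfolding det_def'[OF mat_carrier] lessThan_atLeast0
  by (intro sum.cong refl arg_cong2[where f="(*)"] prod.cong)
    (auto dest: permutes_in_image)

lemma det_mat_cong:
  assumes "\<And>i j. i < n \<Longrightarrow> j < n \<Longrightarrow> f i j = g i j"
  shows "det (mat n n (\<lambda>(i, j). f i j)) = det (mat n n (\<lambda>(i, j). g i j))"
  by (intro arg_cong[where f=det] eq_matI) (auto simp: assms)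

lemma det_mat_scale_rows:
  "det (mat n n (\<lambda>(i, j). c i * f i j)) = (\<Prod>i<n. c i) * det (mat n n (\<lambda>(i, j). f i j))"
  unfolding det_mat_leibniz by (simp add: prod.distrib sum_distrib_left mult_ac)

lemma det_mat_scale_cols:
  "det (mat n n (\<lambda>(i, j). c j * f i j)) = (\<Prod>j<n. c j) * det (mat n n (\<lambda>(i, j). f i j))"
proof -
  have "(\<Prod>i<n. c (p i)) = (\<Prod>j<n. c j)" if "p permutes {0..<n}" for p
    using that by (intro prod.reindex_bij_betw permutes_imp_bij) (simp add: lessThan_atLeast0)
  then show ?thesis
    unfolding det_mat_leibniz by (simp add: prod.distrib sum_distrib_left mult_ac)
qed

lemma poly_eq_sum_lessThan:
  fixes p :: "'a :: comm_semiring_1 poly"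
  assumes "degree p < n"
  shows "poly p x = (\<Sum>i<n. coeff p i * x ^ i)"
  unfolding poly_altdef using assms
  by (intro sum.mono_neutral_left) (auto simp: coeff_eq_0)

text \<open>The rows expand in the monomial basis, and the degree bound keeps the coefficient matrix
  square. The first factor does not involve the points \<open>v\<close>, so it can be computed at
  any convenient points.\<close>

lemma det_poly_eval:
  assumes "\<And>i. i < n \<Longrightarrow> degree (P i) < n"
  shows "det (mat n n (\<lambda>(i, j). poly (P i) (v j))) =
    det (mat n n (\<lambda>(i, k). coeff (P i) k)) * det (mat n n (\<lambda>(k, j). v j ^ k))"
proof -
  have "mat n n (\<lambda>(i, j). poly (P i) (v j)) =
    mat n n (\<lambda>(i, k). coeff (P i) k) * mat n n (\<lambda>(k, j). v j ^ k)"
    using assms by (intro eq_matI)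
      (auto simp: scalar_prod_def poly_eq_sum_lessThan[where n = n] lessThan_atLeast0)
  then show ?thesis
    by (simp add: det_mult[OF mat_carrier mat_carrier])
qed

lemma det_mat_upper_triangular:
  assumes "\<And>i j. j < i \<Longrightarrow> i < n \<Longrightarrow> f i j = 0"
  shows "det (mat n n (\<lambda>(i, j). f i j)) = (\<Prod>i<n. f i i)"
proof -
  have "upper_triangular (mat n n (\<lambda>(i, j). f i j))"
    using assms by auto
  from det_upper_triangular[OF this mat_carrier] show ?thesis
    by (simp add: prod_list_diag_prod lessThan_atLeast0)
qed

lemma det_mat_lower_triangular:
  assumes "\<And>i j. i < j \<Longrightarrow> j < n \<Longrightarrow> f i j = 0"
  shows "det (mat n n (\<lambda>(i, j). f i j)) = (\<Prod>i<n. f i i)"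
proof -
  have "det (mat n n (\<lambda>(i, j). f i j)) = prod_list (diag_mat (mat n n (\<lambda>(i, j). f i j)))"
    using assms by (intro det_lower_triangular[OF _ mat_carrier]) auto
  then show ?thesis
    by (simp add: prod_list_diag_prod lessThan_atLeast0)
qed

text \<open>In the Newton basis of products of \<open>X - v k\<close> over \<open>k < i\<close>, the
  coefficient matrix is lower triangular with ones on the diagonal, while the matrix of values is
  upper triangular. Comparing the two needs no division.\<close>

lemma det_vandermonde:
  fixes v :: "nat \<Rightarrow> 'a :: idom"
  shows "det (mat n n (\<lambda>(k, j). v j ^ k)) = (\<Prod>j<n. \<Prod>i<j. v j - v i)"
proof -
  define P where "P i = (\<Prod>k<i. [:- v k, 1:])" for i
  have deg: "degree (P i) = i" and lead: "coeff (P i) i = 1" for i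
  proof -
    show "degree (P i) = i"
      unfolding P_def by (subst degree_prod_eq_sum_degree) auto
    moreover have "lead_coeff (P i) = 1"
      unfolding P_def by (simp add: lead_coeff_prod)
    ultimately show "coeff (P i) i = 1" by simp
  qed
  have eval: "poly (P i) x = (\<Prod>k<i. x - v k)" for i x
    by (simp add: P_def poly_prod)
  have "det (mat n n (\<lambda>(i, k). coeff (P i) k)) = (\<Prod>i<n. coeff (P i) i)"
    by (rule det_mat_lower_triangular) (simp add: coeff_eq_0 deg)
  then have "det (mat n n (\<lambda>(i, j). poly (P i) (v j))) = det (mat n n (\<lambda>(k, j). v j ^ k))"
    by (subst det_poly_eval) (auto simp: deg lead)
  moreover have "det (mat n n (\<lambda>(i, j). poly (P i) (v j))) = (\<Prod>i<n. poly (P i) (v i))"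
    by (rule det_mat_upper_triangular) (auto simp: eval)
  ultimately show ?thesis by (simp add: eval)
qed

section \<open>Products over pairs of indices, and the Cauchy-Vandermonde determinant\<close>

lemma prod_lessThan_add:
  fixes f :: "nat \<Rightarrow> 'a :: comm_monoid_mult"
  shows "(\<Prod>i<n + m. f i) = (\<Prod>i<n. f i) * (\<Prod>i<m. f (n + i))"
  by (induction m) (auto simp: mult_ac)

text \<open>Pairs are sorted by block: both in the first, one in each, both in the second.
  Vandermonde products of a concatenated list of points are split in this way.\<close>

lemma prod_pairs_add:
  "(\<Prod>j<n + m. \<Prod>i<j. f i j) =
    (\<Prod>j<n. \<Prod>i<j. f i j) * (\<Prod>i<n. \<Prod>j<m. f i (n + j)) *
    (\<Prod>j<m. \<Prod>i<j. f (n + i) (n + j :: nat) :: 'a :: comm_monoid_mult)"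
  by (simp add: prod_lessThan_add prod.distrib prod.swap[of _ "{..<n}"] mult_ac)

lemma prod_off_diagonal:
  "(\<Prod>i<n. \<Prod>j\<in>{..<n} - {i}. f i (j :: nat)) =
    (\<Prod>j<n. \<Prod>i<j. f i j) * (\<Prod>j<n. \<Prod>i<j. f j i :: 'a :: comm_monoid_mult)"
proof (induction n)
  case (Suc n)
  have "(\<Prod>i<n. \<Prod>j\<in>{..<Suc n} - {i}. f i j) = (\<Prod>i<n. f i n * (\<Prod>j\<in>{..<n} - {i}. f i j))"
  proof (intro prod.cong refl)
    fix i assume "i \<in> {..<n}"
    then have "{..<Suc n} - {i} = insert n ({..<n} - {i})" by auto
    then show "(\<Prod>j\<in>{..<Suc n} - {i}. f i j) = f i n * (\<Prod>j\<in>{..<n} - {i}. f i j)" by simp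
  qed
  moreover have "{..<Suc n} - {n} = {..<n}" by auto
  ultimately show ?case
    using Suc by (simp add: prod.distrib mult_ac)
qed simp

text \<open>Multiplying column \<open>p\<close> by the value at \<open>v p\<close> of the product
  \<open>Q\<close> of all denominators turns every row into values of a polynomial of degree below
  \<open>K + l\<close>; here \<open>e i \<le> l\<close> enters. By \<open>det_poly_eval\<close> the
  result is a Vandermonde product times a constant \<open>C\<close> independent of \<open>v\<close>.
  The homogeneous denominators \<open>b i * v p - a i\<close> cover both kinds of Cauchy rows of the
  application.\<close>

lemma det_cauchy_vandermonde:
  fixes a b v :: "nat \<Rightarrow> real"
  assumes b: "\<And>i. i < K \<Longrightarrow> b i \<noteq> 0"
    and dist: "\<And>i j. i < j \<Longrightarrow> j < K \<Longrightarrow> a i * b j \<noteq> a j * b i"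
    and e: "\<And>i. i < K \<Longrightarrow> e i \<le> l"
    and nz: "\<And>i p. i < K \<Longrightarrow> p < K + l \<Longrightarrow> b i * v p \<noteq> a i"
  shows "det (mat (K + l) (K + l)
      (\<lambda>(i, p). if i < K then v p ^ e i / (b i * v p - a i) else v p ^ (i - K))) =
    (\<Prod>i<K. a i ^ e i * b i ^ (l - e i)) * (\<Prod>j<K. \<Prod>i<j. a i * b j - a j * b i) *
    (\<Prod>j<K + l. \<Prod>i<j. v j - v i) / (\<Prod>p<K + l. \<Prod>i<K. b i * v p - a i)"
proof -
  define Q where "Q = (\<Prod>i<K. [:- a i, b i:])"
  define R where "R i = (\<Prod>j\<in>{..<K} - {i}. [:- a j, b j:])" for i
  define P where "P i = (if i < K then monom 1 (e i) * R i else monom 1 (i - K) * Q)" for i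
  define C where "C = det (mat (K + l) (K + l) (\<lambda>(i, k). coeff (P i) k))"
  define c where "c i = a i / b i" for i
  \<comment> \<open>The points \<open>w j\<close> increase with \<open>j\<close> and exceed every
    zero \<open>c i\<close> of \<open>Q\<close>, so all entries of \<open>u\<close> are distinct and
    their Vandermonde product can be cancelled.\<close>
  define w where "w j = 1 + (\<Sum>i<K. \<bar>c i\<bar>) + real j" for j
  define u where "u p = (if p < K then c p else w (p - K))" for p
  have poly_Q: "poly Q x = (\<Prod>i<K. b i * x - a i)" for x
    by (simp add: Q_def poly_prod algebra_simps)
  have poly_R: "poly (R i) x = (\<Prod>j\<in>{..<K} - {i}. b j * x - a j)" for i x
    by (simp add: R_def poly_prod algebra_simps)
  have poly_QR: "poly Q x = (b i * x - a i) * poly (R i) x" if "i < K" for i x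
    using that by (simp add: poly_Q poly_R prod.remove[of _ i])
  have deg1: "(degree \<circ> (\<lambda>j. [:- a j, b j:])) j \<le> 1" for j
    by simp
  have deg: "degree (P i) < K + l" if "i < K + l" for i
  proof (cases "i < K")
    case True
    have "degree (P i) \<le> e i + degree (R i)"
      using True degree_mult_le[of "monom 1 (e i)" "R i"] degree_monom_le[of "1::real" "e i"]
      by (simp add: P_def)
    moreover have "degree (R i) \<le> (\<Sum>j\<in>{..<K} - {i}. 1)"
      unfolding R_def by (intro order.trans[OF degree_prod_sum_le] sum_mono deg1) simp
    ultimately show ?thesis using e[OF True] True by simp
  next
    case False
    have "degree (P i) \<le> (i - K) + degree Q"
      using False degree_mult_le[of "monom 1 (i - K)" Q] degree_monom_le[of "1::real" "i - K"]
      by (simp add: P_def)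
    moreover have "degree Q \<le> (\<Sum>j<K. 1)"
      unfolding Q_def by (intro order.trans[OF degree_prod_sum_le] sum_mono deg1) simp
    ultimately show ?thesis using that False by simp
  qed
  have eval: "det (mat (K + l) (K + l) (\<lambda>(i, p). poly (P i) (z p))) =
    C * (\<Prod>j<K + l. \<Prod>i<j. z j - z i)" for z
    unfolding C_def det_vandermonde[symmetric] by (rule det_poly_eval) (rule deg)
  have Qv: "poly Q (v p) \<noteq> 0" if "p < K + l" for p
    using nz that by (simp add: poly_Q)
  have "det (mat (K + l) (K + l) (\<lambda>(i, p). poly (P i) (v p))) =
    det (mat (K + l) (K + l) (\<lambda>(i, p). poly Q (v p) *
      (if i < K then v p ^ e i / (b i * v p - a i) else v p ^ (i - K))))"
    by (rule det_mat_cong) (use nz in \<open>auto simp: P_def poly_QR poly_monom\<close>)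
  then have main: "(\<Prod>p<K + l. poly Q (v p)) * det (mat (K + l) (K + l)
      (\<lambda>(i, p). if i < K then v p ^ e i / (b i * v p - a i) else v p ^ (i - K))) =
    C * (\<Prod>j<K + l. \<Prod>i<j. v j - v i)"
    by (simp only: eval det_mat_scale_cols)

  \<comment> \<open>The constant C is read off at the zeros of Q, completed by arbitrary further points.\<close>
  have cw: "c i < w j" if "i < K" for i j
  proof -
    have "\<bar>c i\<bar> \<le> (\<Sum>i<K. \<bar>c i\<bar>)"
      using that by (intro member_le_sum) auto
    then show ?thesis by (simp add: w_def)
  qed
  have bc: "b j * x - a j = b j * (x - c j)" if "j < K" for j x
    using b[OF that] by (simp add: c_def field_simps)
  have Qc: "poly Q (c i) = 0" if "i < K" for i
    using that b by (simp add: poly_QR c_def)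
  \<comment> \<open>The last \<open>l\<close> rows carry the factor \<open>Q\<close>, which vanishes
    in the first \<open>K\<close> columns; hence the zero block.\<close>
  have "mat (K + l) (K + l) (\<lambda>(i, p). poly (P i) (u p)) =
    four_block_mat (mat K K (\<lambda>(i, p). poly (P i) (c p)))
      (mat K l (\<lambda>(i, p). poly (P i) (w p))) (0\<^sub>m l K)
      (mat l l (\<lambda>(k, p). poly Q (w p) * w p ^ k))"
    by (rule eq_matI) (auto simp: u_def P_def Qc poly_monom)
  then have "C * (\<Prod>j<K + l. \<Prod>i<j. u j - u i) =
    det (mat K K (\<lambda>(i, p). poly (P i) (c p))) *
    det (mat l l (\<lambda>(k, p). poly Q (w p) * w p ^ k))"
    unfolding eval[symmetric]
    by (simp add: det_four_block_mat_lower_left_zero[OF mat_carrier mat_carrier _ mat_carrier])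
  also have "det (mat K K (\<lambda>(i, p). poly (P i) (c p))) = (\<Prod>i<K. poly (P i) (c i))"
  \<comment> \<open>\<open>R i\<close> contains the factor vanishing at \<open>c j\<close> for every
    \<open>j\<close> other than \<open>i\<close>.\<close>
  proof (rule det_mat_upper_triangular)
    fix i j assume "j < i" "i < K"
    then show "poly (P i) (c j) = 0"
      using b by (auto simp: P_def poly_R c_def intro!: bexI[of _ j])
  qed
  also have "\<dots> = (\<Prod>i<K. c i ^ e i) * (\<Prod>i<K. \<Prod>j\<in>{..<K} - {i}. b j * c i - a j)"
    by (simp add: P_def poly_monom poly_R prod.distrib)
  also have "(\<Prod>i<K. \<Prod>j\<in>{..<K} - {i}. b j * c i - a j) =
    (\<Prod>j<K. \<Prod>i<j. b j * c i - a j) * (\<Prod>j<K. \<Prod>i<j. b i * (c j - c i))"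
    by (simp add: prod_off_diagonal bc)
  \<comment> \<open>Moving \<open>b i\<close> to the other factor uses
    \<open>b i * (b j * c i - a j) = a i * b j - a j * b i\<close> and leaves the Vandermonde
    product of the \<open>c i\<close>, which also divides the left-hand side.\<close>
  also have "\<dots> = (\<Prod>j<K. \<Prod>i<j. a i * b j - a j * b i) * (\<Prod>j<K. \<Prod>i<j. c j - c i)"
    unfolding prod.distrib[symmetric]
    by (intro prod.cong refl) (use b in \<open>auto simp: c_def field_simps\<close>)
  also have "det (mat l l (\<lambda>(k, p). poly Q (w p) * w p ^ k)) =
    (\<Prod>p<l. poly Q (w p)) * (\<Prod>j<l. \<Prod>i<j. w j - w i)"
    by (simp add: det_mat_scale_cols det_vandermonde)
  also have "(\<Prod>p<l. poly Q (w p)) = (\<Prod>i<K. b i ^ l) * (\<Prod>i<K. \<Prod>j<l. w j - c i)"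
    by (simp add: poly_Q bc prod.swap[of _ "{..<K}"] prod.distrib prod_power_distrib)
  also have "(\<Prod>j<K + l. \<Prod>i<j. u j - u i) =
    (\<Prod>j<K. \<Prod>i<j. c j - c i) * (\<Prod>i<K. \<Prod>j<l. w j - c i) * (\<Prod>j<l. \<Prod>i<j. w j - w i)"
    by (simp add: prod_pairs_add u_def cong: prod.cong_simp)
  finally have "C * ((\<Prod>j<K. \<Prod>i<j. c j - c i) * (\<Prod>i<K. \<Prod>j<l. w j - c i) *
      (\<Prod>j<l. \<Prod>i<j. w j - w i)) =
    ((\<Prod>i<K. c i ^ e i) * (\<Prod>i<K. b i ^ l) * (\<Prod>j<K. \<Prod>i<j. a i * b j - a j * b i)) *
    ((\<Prod>j<K. \<Prod>i<j. c j - c i) * (\<Prod>i<K. \<Prod>j<l. w j - c i) *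
      (\<Prod>j<l. \<Prod>i<j. w j - w i))"
    by (simp only: mult_ac)
  moreover have "c j \<noteq> c i" if "i < j" "j < K" for i j
    using dist[OF that] b that by (simp add: c_def field_simps)
  then have "(\<Prod>j<K. \<Prod>i<j. c j - c i) \<noteq> 0"
    by auto
  moreover have "w j \<noteq> c i" if "i < K" for i j
    using cw[OF that, of j] by simp
  then have "(\<Prod>i<K. \<Prod>j<l. w j - c i) \<noteq> 0"
    by auto
  moreover have "(\<Prod>j<l. \<Prod>i<j. w j - w i) \<noteq> 0"
    by (auto simp: w_def)
  ultimately have "C = (\<Prod>i<K. c i ^ e i) * (\<Prod>i<K. b i ^ l) *
      (\<Prod>j<K. \<Prod>i<j. a i * b j - a j * b i)"
    by simp
  also have "(\<Prod>i<K. c i ^ e i) * (\<Prod>i<K. b i ^ l) = (\<Prod>i<K. a i ^ e i * b i ^ (l - e i))"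
    unfolding prod.distrib[symmetric]
    by (intro prod.cong refl) (use b e in \<open>auto simp: c_def power_divide power_diff\<close>)
  finally show ?thesis
    using main Qv by (simp add: poly_Q[symmetric] field_simps)
qed

section \<open>Sums over multi-indices\<close>

lemma has_sum_sum:
  fixes f :: "'i \<Rightarrow> 'a \<Rightarrow> 'b :: topological_comm_monoid_add"
  assumes "\<And>i. i \<in> I \<Longrightarrow> (f i has_sum s i) A"
  shows "((\<lambda>x. \<Sum>i\<in>I. f i x) has_sum (\<Sum>i\<in>I. s i)) A"
  using assms by (induction I rule: infinite_finite_induct) (auto intro!: has_sum_add)

text \<open>This is Tonelli: nonnegativity yields summability on the product from the iterated
  sums.\<close>

lemma has_sum_Times_nonneg:
  fixes f :: "'a \<Rightarrow> real" and g :: "'b \<Rightarrow> real"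
  assumes f: "(f has_sum S) A" "\<And>x. x \<in> A \<Longrightarrow> 0 \<le> f x"
    and g: "(g has_sum T) B" "\<And>y. y \<in> B \<Longrightarrow> 0 \<le> g y"
  shows "((\<lambda>(x, y). f x * g y) has_sum S * T) (A \<times> B)"
proof (rule has_sum_SigmaI)
  show inner: "((\<lambda>y. case (x, y) of (x, y) \<Rightarrow> f x * g y) has_sum f x * T) B" for x
    using g(1) by (auto intro: has_sum_cmult_right)
  show outer: "((\<lambda>x. f x * T) has_sum S * T) A"
    by (intro has_sum_cmult_left f)
  show "(\<lambda>(x, y). f x * g y) summable_on A \<times> B"
    by (rule summable_on_SigmaI[OF inner])
      (use outer f g in \<open>auto simp: has_sum_imp_summable\<close>)
qed

text \<open>Induction on the index set: updating at the new index is a bijection from pairs (value,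
  remaining function) onto the larger extensional function space.\<close>

lemma has_sum_PiE_prod:
  fixes f :: "'i \<Rightarrow> 'a \<Rightarrow> real"
  assumes "finite A"
    and "\<And>i. i \<in> A \<Longrightarrow> (f i has_sum S i) (B i)"
    and "\<And>i x. i \<in> A \<Longrightarrow> x \<in> B i \<Longrightarrow> 0 \<le> f i x"
  shows "((\<lambda>g. \<Prod>i\<in>A. f i (g i)) has_sum (\<Prod>i\<in>A. S i)) (PiE A B)"
  using assms
proof (induction A rule: finite_induct)
  case empty
  then show ?case by (simp add: has_sum_finiteI)
next
  case (insert x A)
  have "((\<lambda>(y, g). f x y * (\<Prod>i\<in>A. f i (g i))) has_sum S x * (\<Prod>i\<in>A. S i))
      (B x \<times> PiE A B)"
    by (rule has_sum_Times_nonneg) (use insert in \<open>auto intro!: prod_nonneg simp: PiE_mem\<close>)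
  also have "?this \<longleftrightarrow> ((\<lambda>g. \<Prod>i\<in>insert x A. f i (g i)) \<circ> (\<lambda>(y, g). g(x := y))
      has_sum S x * (\<Prod>i\<in>A. S i)) (B x \<times> PiE A B)"
  proof (rule has_sum_cong, clarsimp)
    fix y g
    have "(\<Prod>i\<in>A. f i (if i = x then y else g i)) = (\<Prod>i\<in>A. f i (g i))"
      using insert by (intro prod.cong) auto
    then show "f x y * (\<Prod>i\<in>A. f i (g i)) = (\<Prod>i\<in>insert x A. f i (if i = x then y else g i))"
      using insert by simp
  qed
  also have "\<dots> \<longleftrightarrow> ((\<lambda>g. \<Prod>i\<in>insert x A. f i (g i)) has_sum S x * (\<Prod>i\<in>A. S i))
      (PiE (insert x A) B)"
    unfolding PiE_insert_eq
    by (rule has_sum_reindex[symmetric]) (use insert in \<open>auto intro: inj_combinator\<close>)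
  finally show ?case using insert by simp
qed

lemma prod_lessThan_add3:
  fixes f :: "nat \<Rightarrow> 'a :: comm_monoid_mult"
  shows "(\<Prod>i<n + m + l. f i) = (\<Prod>i<n. f i) * (\<Prod>i<m. f (n + i)) * (\<Prod>i<l. f (n + m + i))"
  by (simp add: prod_lessThan_add)

text \<open>Each of the first \<open>n + m\<close> rows depends on a single coordinate of the
  multi-index, so every Leibniz term is a product of functions of separate coordinates and sums
  factor by factor. Signs and the constant rows \<open>H\<close> stay outside the sum, so
  nonnegativity is required of \<open>F\<close> and \<open>G\<close> only.\<close>

lemma has_sum_det_rows:
  fixes F G :: "nat \<Rightarrow> nat \<Rightarrow> nat \<Rightarrow> real"
  assumes F: "\<And>i p. i < n \<Longrightarrow> p < n + m + l \<Longrightarrow> (F i p has_sum S i p) UNIV"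
      "\<And>i p x. i < n \<Longrightarrow> p < n + m + l \<Longrightarrow> 0 \<le> F i p x"
    and G: "\<And>j p. j < m \<Longrightarrow> p < n + m + l \<Longrightarrow> (G j p has_sum T j p) UNIV"
      "\<And>j p x. j < m \<Longrightarrow> p < n + m + l \<Longrightarrow> 0 \<le> G j p x"
  shows "((\<lambda>(k, k'). det (mat (n + m + l) (n + m + l) (\<lambda>(i, p).
        if i < n then F i p (k (Suc i)) else if i < n + m then G (i - n) p (k' (Suc (i - n)))
        else H i p))) has_sum
      det (mat (n + m + l) (n + m + l) (\<lambda>(i, p).
        if i < n then S i p else if i < n + m then T (i - n) p else H i p)))
      (({1..n} \<rightarrow>\<^sub>E UNIV) \<times> ({1..m} \<rightarrow>\<^sub>E UNIV))"
proof -
  let ?N = "n + m + l"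
  let ?X = "({1..n} \<rightarrow>\<^sub>E (UNIV :: nat set)) \<times> ({1..m} \<rightarrow>\<^sub>E (UNIV :: nat set))"
  have "((\<lambda>z. \<Sum>p | p permutes {0..<?N}. signof p *
      (case z of (k, k') \<Rightarrow> (\<Prod>i<n. F i (p i) (k (Suc i))) *
         (\<Prod>j<m. G j (p (n + j)) (k' (Suc j)))) * (\<Prod>i<l. H (n + m + i) (p (n + m + i)))) has_sum
    (\<Sum>p | p permutes {0..<?N}. signof p * ((\<Prod>i<n. S i (p i)) * (\<Prod>j<m. T j (p (n + j)))) *
       (\<Prod>i<l. H (n + m + i) (p (n + m + i))))) ?X"
  proof (intro has_sum_sum has_sum_cmult_right has_sum_cmult_left)
    fix p assume "p \<in> {p. p permutes {0..<?N}}"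
    then have p: "p i < ?N" if "i < ?N" for i
      using that by (auto dest: permutes_in_image)
    \<comment> \<open>Coordinates are numbered from 1 and rows from 0, hence the shift by
      one.\<close>
    have "((\<lambda>k. \<Prod>i\<in>{1..n}. F (i - 1) (p (i - 1)) (k i)) has_sum
        (\<Prod>i\<in>{1..n}. S (i - 1) (p (i - 1)))) ({1..n} \<rightarrow>\<^sub>E UNIV)"
      by (rule has_sum_PiE_prod) (auto intro!: F p)
    moreover have "((\<lambda>k. \<Prod>j\<in>{1..m}. G (j - 1) (p (n + (j - 1))) (k j)) has_sum
        (\<Prod>j\<in>{1..m}. T (j - 1) (p (n + (j - 1))))) ({1..m} \<rightarrow>\<^sub>E UNIV)"
      by (rule has_sum_PiE_prod) (auto intro!: G p)
    ultimately show "((\<lambda>(k, k'). (\<Prod>i<n. F i (p i) (k (Suc i))) *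
         (\<Prod>j<m. G j (p (n + j)) (k' (Suc j)))) has_sum
       (\<Prod>i<n. S i (p i)) * (\<Prod>j<m. T j (p (n + j)))) ?X"
      unfolding One_nat_def prod.atLeast1_atMost_eq diff_Suc_Suc diff_zero
      by (intro has_sum_Times_nonneg) (auto intro!: prod_nonneg F G p)
  qed
  then show ?thesis
    unfolding det_mat_leibniz prod_lessThan_add3
    by (simp add: case_prod_unfold mult_ac cong: prod.cong_simp)
qed

section \<open>The integral as a determinant\<close>

lemma prod_pairs_from_1:
  "(\<Prod>i=1..n. \<Prod>j=i+1..n. f i j) =
    (\<Prod>j<n. \<Prod>i<j. f (Suc i) (Suc j) :: 'a :: comm_monoid_mult)"
proof (induction n)
  case (Suc n)
  have "(\<Prod>i=1..Suc n. \<Prod>j=i+1..Suc n. f i j) = (\<Prod>i=1..n. \<Prod>j=i+1..Suc n. f i j)"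
    by simp
  also have "\<dots> = (\<Prod>i=1..n. (\<Prod>j=i+1..n. f i j) * f i (Suc n))"
    by (intro prod.cong) auto
  also have "\<dots> = (\<Prod>j<n. \<Prod>i<j. f (Suc i) (Suc j)) * (\<Prod>i=1..n. f i (Suc n))"
    by (simp only: prod.distrib Suc)
  finally show ?case
    by (simp add: prod.atLeast1_atMost_eq)
qed simp

lemma det_vandermonde_rows:
  fixes v :: "nat \<Rightarrow> 'a :: idom"
  shows "det (mat n n (\<lambda>(i, p). v i ^ p)) = (\<Prod>j<n. \<Prod>i<j. v j - v i)"
proof -
  have "mat n n (\<lambda>(i, p). v i ^ p) = transpose_mat (mat n n (\<lambda>(p, i). v i ^ p))"
    by (rule eq_matI) auto
  then show ?thesis
    by (simp add: det_transpose[OF mat_carrier] det_vandermonde)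
qed

text \<open>Taking \<open>a i ^ (n - 1)\<close> out of row \<open>i\<close> leaves a Vandermonde
  determinant in the ratios \<open>b i / a i\<close>. The \<open>n - 1\<close> extracted factors are
  handed out one to each pair containing \<open>i\<close>, where they clear the
  denominators.\<close>

lemma det_vandermonde_homogeneous:
  fixes a b :: "nat \<Rightarrow> 'a :: field"
  assumes "\<And>i. i < n \<Longrightarrow> a i \<noteq> 0"
  shows "det (mat n n (\<lambda>(i, p). a i ^ (n - 1 - p) * b i ^ p)) =
    (\<Prod>j<n. \<Prod>i<j. a i * b j - a j * b i)"
proof -
  have "det (mat n n (\<lambda>(i, p). a i ^ (n - 1 - p) * b i ^ p)) =
    det (mat n n (\<lambda>(i, p). a i ^ (n - 1) * (b i / a i) ^ p))"
    by (rule det_mat_cong) (use assms in \<open>auto simp: power_diff power_divide\<close>)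
  also have "\<dots> = (\<Prod>i<n. a i ^ (n - 1)) * (\<Prod>j<n. \<Prod>i<j. b j / a j - b i / a i)"
    by (simp add: det_mat_scale_rows det_vandermonde_rows)
  also have "(\<Prod>i<n. a i ^ (n - 1)) = (\<Prod>i<n. \<Prod>j\<in>{..<n} - {i}. a i)"
    by simp
  also have "\<dots> = (\<Prod>j<n. \<Prod>i<j. a i) * (\<Prod>j<n. \<Prod>i<j. a j)"
    by (rule prod_off_diagonal)
  also have "\<dots> * (\<Prod>j<n. \<Prod>i<j. b j / a j - b i / a i) =
    (\<Prod>j<n. \<Prod>i<j. a i * b j - a j * b i)"
    unfolding prod.distrib[symmetric]
    by (intro prod.cong refl) (use assms in \<open>auto simp: field_simps\<close>)
  finally show ?thesis .
qed

text \<open>Expanding the second copies of the Vandermonde products permutes the exponents within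
  each of the first two row blocks. This restores their order at the cost of the two signs.\<close>

lemma det_permute_block_rows:
  assumes \<tau>: "\<tau> permutes {0..<n}" and \<rho>: "\<rho> permutes {0..<m}"
  shows "det (mat (n + m + l) (n + m + l) (\<lambda>(i, p).
      if i < n then A (\<tau> i) p else if i < n + m then B (\<rho> (i - n)) p else H i p)) =
    signof \<tau> * signof \<rho> * det (mat (n + m + l) (n + m + l) (\<lambda>(i, p).
      if i < n then A i p else if i < n + m then B (i - n) p else H i p))"
proof -
  let ?N = "n + m + l"
  \<comment> \<open>\<open>\<pi>\<close> is \<open>\<rho>\<close> carried to the second block of
    rows by the shift by \<open>n\<close>; this transport preserves the sign.\<close>
  define \<pi> where "\<pi> = map_permutation {0..<m} (\<lambda>i. n + i) \<rho>"
  have "bij_betw (\<lambda>i. n + i) {0..<m} {n..<n + m}"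
    by (rule bij_betwI[of _ _ _ "\<lambda>i. i - n"]) auto
  then have \<pi>: "\<pi> permutes {n..<n + m}"
    unfolding \<pi>_def using \<rho> by (rule map_permutation_permutes)
  then have \<pi>_N: "\<pi> permutes {0..<?N}"
    by (rule permutes_subset) auto
  have \<pi>_id: "\<pi> i = i" if "i < n \<or> n + m \<le> i" for i
    using permutes_not_in[OF \<pi>, of i] that by auto
  have \<pi>_apply: "\<pi> i = n + \<rho> (i - n)" "\<rho> (i - n) < m" if "n \<le> i" "i < n + m" for i
  proof -
    have "\<pi> (n + (i - n)) = n + \<rho> (i - n)"
      unfolding \<pi>_def by (rule map_permutation_apply) (use that in auto)
    then show "\<pi> i = n + \<rho> (i - n)" using that by simp
    show "\<rho> (i - n) < m"
      using permutes_in_image[OF \<rho>, of "i - n"] that by auto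
  qed
  have \<tau>_N: "\<tau> permutes {0..<?N}"
    using \<tau> by (rule permutes_subset) auto
  have \<tau>_lt: "\<tau> i < n \<longleftrightarrow> i < n" and \<tau>_id: "\<not> i < n \<Longrightarrow> \<tau> i = i" for i
    using permutes_in_image[OF \<tau>, of i] permutes_not_in[OF \<tau>, of i] by auto
  have "det (mat ?N ?N (\<lambda>(i, p).
      if i < n then A (\<tau> i) p else if i < n + m then B (\<rho> (i - n)) p else H i p)) =
    det (mat ?N ?N (\<lambda>(i, p). mat ?N ?N (\<lambda>(i, p).
      if i < n then A i p else if i < n + m then B (\<rho> (i - n)) p else H i p) $$ (\<tau> i, p)))"
    using permutes_in_image[OF \<tau>_N]
    by (intro det_mat_cong) (auto simp: \<tau>_lt \<tau>_id)
  also have "\<dots> = signof \<tau> * det (mat ?N ?N (\<lambda>(i, p).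
      if i < n then A i p else if i < n + m then B (\<rho> (i - n)) p else H i p))"
    by (rule det_permute_rows[OF mat_carrier \<tau>_N])
  also have "det (mat ?N ?N (\<lambda>(i, p).
      if i < n then A i p else if i < n + m then B (\<rho> (i - n)) p else H i p)) =
    det (mat ?N ?N (\<lambda>(i, p). mat ?N ?N (\<lambda>(i, p).
      if i < n then A i p else if i < n + m then B (i - n) p else H i p) $$ (\<pi> i, p)))"
    by (intro det_mat_cong) (auto simp: \<pi>_id \<pi>_apply trans_less_add1)
  also have "\<dots> = signof \<pi> * det (mat ?N ?N (\<lambda>(i, p).
      if i < n then A i p else if i < n + m then B (i - n) p else H i p))"
    by (rule det_permute_rows[OF mat_carrier \<pi>_N])
  also have "sign \<pi> = sign \<rho>"
    unfolding \<pi>_def by (rule sign_map_permutation) (use \<rho> in auto)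
  finally show ?thesis by (simp add: mult.assoc)
qed

text \<open>
  The Vandermonde determinant in the homogeneous coordinates $(x_i:1)$, $(1:q^{l+1}y_j)$ and
  $(1:q^k)$, which avoids dividing by $y_j$.
\<close>

definition row_det :: "real \<Rightarrow> nat \<Rightarrow> nat \<Rightarrow> nat \<Rightarrow> (nat \<Rightarrow> real) \<Rightarrow> (nat \<Rightarrow> real) \<Rightarrow> real" where
  "row_det q n m l x y = det (mat (n + m + l) (n + m + l) (\<lambda>(i, p).
     if i < n then x (Suc i) ^ (n + m + l - 1 - p)
     else if i < n + m then (q ^ (l + 1) * y (Suc (i - n))) ^ p
     else (q ^ Suc (i - n - m)) ^ p))"

text \<open>The factors come from the pairs of blocks, with the \<open>l\<close> constant points as
  third block. The signs belong to the pairs x-x, x-y and x-constant; the remaining three products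
  belong to y-y, y-constant and constant-constant.\<close>

definition row_det_const :: "real \<Rightarrow> nat \<Rightarrow> nat \<Rightarrow> nat \<Rightarrow> real" where
  "row_det_const q n m l = (\<Prod>j<n. \<Prod>i<j. -1) * (-1) ^ (n * m) * (-1) ^ (n * l) *
     (\<Prod>j<m. \<Prod>i<j. q ^ (l + 1)) * (\<Prod>k<l. q ^ Suc k) ^ m *
     (\<Prod>j<l. \<Prod>i<j. q ^ Suc j - q ^ Suc i)"

text \<open>The homogeneous Vandermonde product splits by blocks: x-x and y-y pairs give the two
  Vandermonde products, x-y pairs the cross factors, and pairs with a constant point the shifted
  q-factorials. The condition on \<open>x\<close> holds at the points \<open>q ^ k i\<close> of the
  Jackson sum.\<close>

lemma row_det_eq:
  assumes x: "\<And>i. x i \<noteq> 0"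
  shows "row_det q n m l x y = row_det_const q n m l *
    (\<Prod>i=1..n. q_poch_shifted q (x i) l) * (\<Prod>j=1..m. q_poch_shifted q (y j) l) *
    (\<Prod>i=1..n. \<Prod>j=1..m. 1 - q ^ (l + 1) * x i * y j) *
    (\<Prod>j<n. \<Prod>i<j. x (Suc j) - x (Suc i)) * (\<Prod>j<m. \<Prod>i<j. y (Suc j) - y (Suc i))"
proof -
  let ?N = "n + m + l" and ?c = "q ^ (l + 1)"
  define a where "a i = (if i < n then x (Suc i) else 1)" for i
  define b where "b i = (if i < n then 1 else if i < n + m then ?c * y (Suc (i - n))
    else q ^ Suc (i - n - m))" for i
  have poch: "q_poch_shifted q z l = (\<Prod>k<l. 1 - q ^ Suc k * z)" for z
    by (simp add: q_poch_shifted_def prod.atLeast1_atMost_eq)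
  \<comment> \<open>Factoring \<open>q ^ Suc k\<close> out leaves the exponents
    \<open>l - k\<close>, which run through \<open>1..l\<close> in reverse. The exponent
    \<open>l + 1\<close> of the cross factors is what makes these the factors of
    \<open>q_poch_shifted\<close>.\<close>
  have poch_rev: "(\<Prod>k<l. q ^ Suc k - ?c * z) = (\<Prod>k<l. q ^ Suc k) * q_poch_shifted q z l" for z
  proof -
    have "(\<Prod>k<l. q ^ Suc k - ?c * z) = (\<Prod>k<l. q ^ Suc k * (1 - q ^ Suc (l - Suc k) * z))"
    proof (rule prod.cong[OF refl])
      fix k assume "k \<in> {..<l}"
      then have "l + 1 = Suc k + Suc (l - Suc k)" by simp
      then have c: "?c = q ^ Suc k * q ^ Suc (l - Suc k)" by (metis power_add)
      show "q ^ Suc k - ?c * z = q ^ Suc k * (1 - q ^ Suc (l - Suc k) * z)"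
        unfolding c by (simp only: right_diff_distrib mult_1_right mult.assoc)
    qed
    also have "\<dots> = (\<Prod>k<l. q ^ Suc k) * (\<Prod>k<l. 1 - q ^ Suc (l - Suc k) * z)"
      by (rule prod.distrib)
    also have "(\<Prod>k<l. 1 - q ^ Suc (l - Suc k) * z) = (\<Prod>k<l. 1 - q ^ Suc k * z)"
      by (rule prod.nat_diff_reindex)
    finally show ?thesis by (simp add: poch)
  qed
  have "row_det q n m l x y = det (mat ?N ?N (\<lambda>(i, p). a i ^ (?N - 1 - p) * b i ^ p))"
    unfolding row_det_def by (rule det_mat_cong) (auto simp: a_def b_def)
  also have "\<dots> = (\<Prod>j<?N. \<Prod>i<j. a i * b j - a j * b i)"
    by (rule det_vandermonde_homogeneous) (simp add: a_def x)
  also have "\<dots> = (\<Prod>j<n. \<Prod>i<j. a i * b j - a j * b i) *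
      (\<Prod>i<n. \<Prod>j<m. a i * b (n + j) - a (n + j) * b i) *
      (\<Prod>j<m. \<Prod>i<j. a (n + i) * b (n + j) - a (n + j) * b (n + i)) *
      ((\<Prod>i<n. \<Prod>k<l. a i * b (n + m + k) - a (n + m + k) * b i) *
       (\<Prod>j<m. \<Prod>k<l. a (n + j) * b (n + m + k) - a (n + m + k) * b (n + j))) *
      (\<Prod>j<l. \<Prod>i<j. a (n + m + i) * b (n + m + j) - a (n + m + j) * b (n + m + i))"
    \<comment> \<open>First the constant block is split off, then x from y, and finally the cross
      product of the combined x-y block with the constants.\<close>
    by (subst prod_pairs_add, subst prod_pairs_add, subst prod_lessThan_add) (simp only: mult_ac)
  also have "(\<Prod>j<n. \<Prod>i<j. a i * b j - a j * b i) =
      (\<Prod>j<n. \<Prod>i<j. (-1) * (x (Suc j) - x (Suc i)))"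
    by (intro prod.cong refl) (auto simp: a_def b_def)
  also have "(\<Prod>i<n. \<Prod>j<m. a i * b (n + j) - a (n + j) * b i) =
      (\<Prod>i<n. \<Prod>j<m. (-1) * (1 - ?c * x (Suc i) * y (Suc j)))"
    by (intro prod.cong refl) (auto simp: a_def b_def)
  also have "(\<Prod>j<m. \<Prod>i<j. a (n + i) * b (n + j) - a (n + j) * b (n + i)) =
      (\<Prod>j<m. \<Prod>i<j. ?c * (y (Suc j) - y (Suc i)))"
    by (intro prod.cong refl) (auto simp: a_def b_def algebra_simps)
  also have "(\<Prod>i<n. \<Prod>k<l. a i * b (n + m + k) - a (n + m + k) * b i) =
      (\<Prod>i<n. \<Prod>k<l. (-1) * (1 - q ^ Suc k * x (Suc i)))"
    by (intro prod.cong refl) (auto simp: a_def b_def)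
  also have "(\<Prod>j<m. \<Prod>k<l. a (n + j) * b (n + m + k) - a (n + m + k) * b (n + j)) =
      (\<Prod>j<m. (\<Prod>k<l. q ^ Suc k) * q_poch_shifted q (y (Suc j)) l)"
    unfolding poch_rev[symmetric] by (intro prod.cong refl) (auto simp: a_def b_def)
  also have "(\<Prod>j<l. \<Prod>i<j. a (n + m + i) * b (n + m + j) - a (n + m + j) * b (n + m + i)) =
      (\<Prod>j<l. \<Prod>i<j. q ^ Suc j - q ^ Suc i)"
    by (intro prod.cong refl) (auto simp: a_def b_def)
  finally show ?thesis
    unfolding prod.distrib row_det_const_def One_nat_def prod.atLeast1_atMost_eq poch
    by (simp add: power_mult[symmetric] mult_ac)
qed

section \<open>Summation of the determinants over the Jackson grid\<close>

lemma has_sum_geometric_real: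
  fixes z :: real
  assumes "0 \<le> z" "z < 1"
  shows "((\<lambda>k. z ^ k) has_sum 1 / (1 - z)) UNIV"
  using assms by (intro norm_summable_imp_has_sum) (auto simp: geometric_sums)

text \<open>Monomials and Jackson weights are absorbed into the rows, so each entry becomes a
  geometric term in one coordinate. Arbitrary exponents \<open>e\<close> and \<open>f\<close> are
  allowed because the expansion over permutations produces them in every order.\<close>

lemma has_sum_monomial_row_det:
  fixes e f :: "nat \<Rightarrow> nat"
  assumes q: "0 < q" "q < 1"
  shows "((\<lambda>(k, k'). (\<Prod>i<n. (q ^ k (Suc i)) ^ e i) * (\<Prod>j<m. (q ^ k' (Suc j)) ^ f j) *
        row_det q n m l (\<lambda>i. q ^ k i) (\<lambda>j. q ^ k' j) *
        q ^ ((\<Sum>i=1..n. k i) + (\<Sum>j=1..m. k' j))) has_sum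
      det (mat (n + m + l) (n + m + l) (\<lambda>(i, p).
        if i < n then 1 / (1 - q ^ (e i + (n + m + l) - p))
        else if i < n + m then (q ^ (l + 1)) ^ p / (1 - q ^ (f (i - n) + p + 1))
        else (q ^ Suc (i - n - m)) ^ p)))
      (({1..n} \<rightarrow>\<^sub>E UNIV) \<times> ({1..m} \<rightarrow>\<^sub>E UNIV))"
proof -
  let ?N = "n + m + l" and ?c = "q ^ (l + 1)"
  let ?X = "({1..n} \<rightarrow>\<^sub>E (UNIV :: nat set)) \<times> ({1..m} \<rightarrow>\<^sub>E (UNIV :: nat set))"
  have geom: "((\<lambda>k. (q ^ d) ^ k) has_sum 1 / (1 - q ^ d)) UNIV" if "0 < d" for d
    using q that by (intro has_sum_geometric_real) (auto simp: power_less_one_iff)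
  have geom_c: "((\<lambda>k. ?c ^ p * (q ^ (f j + p + 1)) ^ k) has_sum
      ?c ^ p * (1 / (1 - q ^ (f j + p + 1)))) UNIV" for j p
    by (intro has_sum_cmult_right geom) simp
  have "((\<lambda>(k, k'). det (mat ?N ?N (\<lambda>(i, p).
        if i < n then (q ^ (e i + ?N - p)) ^ k (Suc i)
        else if i < n + m then ?c ^ p * (q ^ (f (i - n) + p + 1)) ^ k' (Suc (i - n))
        else (q ^ Suc (i - n - m)) ^ p))) has_sum
      det (mat ?N ?N (\<lambda>(i, p).
        if i < n then 1 / (1 - q ^ (e i + ?N - p))
        else if i < n + m then ?c ^ p * (1 / (1 - q ^ (f (i - n) + p + 1)))
        else (q ^ Suc (i - n - m)) ^ p))) ?X"
    by (rule has_sum_det_rows, rule geom, simp, use q in simp, rule geom_c, use q in simp)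
  also have "?this \<longleftrightarrow> ?thesis"
  proof (rule arg_cong2[where f = "\<lambda>f s. (f has_sum s) ?X"], intro ext, clarify)
    fix k k' :: "nat \<Rightarrow> nat"
    \<comment> \<open>\<open>w i\<close> is the factor of row \<open>i\<close>: the monomial times
      one power from the weight of the Jackson sum, and 1 on constant rows.\<close>
    define w where "w i = (if i < n then (q ^ k (Suc i)) ^ e i * q ^ k (Suc i)
      else if i < n + m then (q ^ k' (Suc (i - n))) ^ f (i - n) * q ^ k' (Suc (i - n)) else 1)" for i
    have swap: "(q ^ u) ^ v = (q ^ v) ^ u" for u v
      by (simp add: power_mult[symmetric] mult.commute)
    have "det (mat ?N ?N (\<lambda>(i, p).
        if i < n then (q ^ (e i + ?N - p)) ^ k (Suc i)
        else if i < n + m then ?c ^ p * (q ^ (f (i - n) + p + 1)) ^ k' (Suc (i - n))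
        else (q ^ Suc (i - n - m)) ^ p)) =
      det (mat ?N ?N (\<lambda>(i, p). w i * (if i < n then (q ^ k (Suc i)) ^ (?N - 1 - p)
        else if i < n + m then (?c * q ^ k' (Suc (i - n))) ^ p
        else (q ^ Suc (i - n - m)) ^ p)))"
    proof (rule det_mat_cong)
      fix i p assume "i < ?N" "p < ?N"
      \<comment> \<open>The three summands come from the monomial, the Jackson weight and the row of
        \<open>row_det\<close>; \<open>p < ?N\<close> keeps the subtraction exact.\<close>
      then have "e i + ?N - p = e i + 1 + (?N - 1 - p)" by simp
      then have "(q ^ (e i + ?N - p)) ^ k (Suc i) =
          (q ^ k (Suc i)) ^ e i * q ^ k (Suc i) * (q ^ k (Suc i)) ^ (?N - 1 - p)"
        by (simp only: power_add power_one_right power_mult_distrib swap[of _ "k (Suc i)"])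
      moreover have "?c ^ p * (q ^ (f (i - n) + p + 1)) ^ k' (Suc (i - n)) =
          (q ^ k' (Suc (i - n))) ^ f (i - n) * q ^ k' (Suc (i - n)) * (?c * q ^ k' (Suc (i - n))) ^ p"
        by (simp only: swap[of _ "k' (Suc (i - n))"] power_add power_one_right power_mult_distrib mult_ac)
      ultimately show "(if i < n then (q ^ (e i + ?N - p)) ^ k (Suc i)
          else if i < n + m then ?c ^ p * (q ^ (f (i - n) + p + 1)) ^ k' (Suc (i - n))
          else (q ^ Suc (i - n - m)) ^ p) =
        w i * (if i < n then (q ^ k (Suc i)) ^ (?N - 1 - p)
          else if i < n + m then (?c * q ^ k' (Suc (i - n))) ^ p
          else (q ^ Suc (i - n - m)) ^ p)"
        by (simp only: w_def mult_1_left split: if_split) simp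
    qed
    also have "\<dots> = (\<Prod>i<?N. w i) * row_det q n m l (\<lambda>i. q ^ k i) (\<lambda>j. q ^ k' j)"
      by (simp only: det_mat_scale_rows row_det_def)
    also have "(\<Prod>i<?N. w i) = (\<Prod>i<n. (q ^ k (Suc i)) ^ e i * q ^ k (Suc i)) *
        (\<Prod>j<m. (q ^ k' (Suc j)) ^ f j * q ^ k' (Suc j))"
      unfolding prod_lessThan_add3 by (simp add: w_def cong: prod.cong_simp)
    also have "\<dots> = (\<Prod>i<n. (q ^ k (Suc i)) ^ e i) * (\<Prod>j<m. (q ^ k' (Suc j)) ^ f j) *
        q ^ ((\<Sum>i=1..n. k i) + (\<Sum>j=1..m. k' j))"
      by (simp add: prod.distrib power_add power_sum prod.atLeast1_atMost_eq mult_ac)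
    finally show "det (mat ?N ?N (\<lambda>(i, p).
        if i < n then (q ^ (e i + ?N - p)) ^ k (Suc i)
        else if i < n + m then ?c ^ p * (q ^ (f (i - n) + p + 1)) ^ k' (Suc (i - n))
        else (q ^ Suc (i - n - m)) ^ p)) =
      (\<Prod>i<n. (q ^ k (Suc i)) ^ e i) * (\<Prod>j<m. (q ^ k' (Suc j)) ^ f j) *
        row_det q n m l (\<lambda>i. q ^ k i) (\<lambda>j. q ^ k' j) *
        q ^ ((\<Sum>i=1..n. k i) + (\<Sum>j=1..m. k' j))"
      by (simp only: mult_ac)
  qed (rule det_mat_cong, simp)
  finally show ?thesis .
qed

text \<open>Up to a factor \<open>1 - q\<close>, an entry of the first \<open>n\<close> rows is the
  Jackson moment of the power \<open>r + i + N - 1 - p\<close>, where \<open>N = n + m + l\<close>;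
  the next \<open>m\<close> rows hold those of the powers \<open>s + j + p\<close>, scaled by
  \<open>(q ^ (l + 1)) ^ p\<close>.\<close>

definition moment_det :: "real \<Rightarrow> nat \<Rightarrow> nat \<Rightarrow> nat \<Rightarrow> nat \<Rightarrow> nat \<Rightarrow> real" where
  "moment_det q n m l r s = det (mat (n + m + l) (n + m + l) (\<lambda>(i, p).
     if i < n then 1 / (1 - q ^ (r + i + (n + m + l) - p))
     else if i < n + m then (q ^ (l + 1)) ^ p / (1 - q ^ (s + (i - n) + p + 1))
     else (q ^ Suc (i - n - m)) ^ p))"

lemma prod_diff_leibniz:
  fixes x :: "nat \<Rightarrow> 'a :: idom"
  shows "(\<Prod>j<n. \<Prod>i<j. x j - x i) = (\<Sum>p | p permutes {0..<n}. signof p * (\<Prod>i<n. x i ^ p i))"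
  by (simp only: det_vandermonde_rows[symmetric] det_mat_leibniz)

text \<open>One copy of each squared Vandermonde product is absorbed by \<open>row_det\<close>, the
  other is expanded over permutations. The sign of each term is undone by sorting the rows, so all
  \<open>n! m!\<close> terms contribute equally. Keeping \<open>row_det_const\<close> as a factor
  avoids a division here.\<close>

lemma jackson_integral_eq_moment_det:
  assumes q: "0 < q" "q < 1"
  shows "jackson_integral q n m (\<lambda>x y.
      (\<Prod>i=1..n. x i ^ r * q_poch_shifted q (x i) l) *
      (\<Prod>j=1..m. y j ^ s * q_poch_shifted q (y j) l) *
      (\<Prod>i=1..n. \<Prod>j=1..m. (1 - q ^ (l + 1) * x i * y j)) *
      (\<Prod>i=1..n. \<Prod>j=i+1..n. (x j - x i)\<^sup>2) *
      (\<Prod>i=1..m. \<Prod>j=i+1..m. (y j - y i)\<^sup>2)) * row_det_const q n m l =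
    (1 - q) ^ (n + m) * fact n * fact m * moment_det q n m l r s"
proof -
  let ?X = "({1..n} \<rightarrow>\<^sub>E (UNIV :: nat set)) \<times> ({1..m} \<rightarrow>\<^sub>E (UNIV :: nat set))"
  define w :: "(nat \<Rightarrow> nat) \<Rightarrow> (nat \<Rightarrow> nat) \<Rightarrow> real"
    where "w k k' = q ^ ((\<Sum>i=1..n. k i) + (\<Sum>j=1..m. k' j))" for k k'
  define g :: "(nat \<Rightarrow> real) \<Rightarrow> (nat \<Rightarrow> real) \<Rightarrow> real" where "g x y =
      (\<Prod>i=1..n. x i ^ r * q_poch_shifted q (x i) l) *
      (\<Prod>j=1..m. y j ^ s * q_poch_shifted q (y j) l) *
      (\<Prod>i=1..n. \<Prod>j=1..m. (1 - q ^ (l + 1) * x i * y j)) *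
      (\<Prod>i=1..n. \<Prod>j=i+1..n. (x j - x i)\<^sup>2) *
      (\<Prod>i=1..m. \<Prod>j=i+1..m. (y j - y i)\<^sup>2)" for x y
  define t where "t \<tau> \<rho> x y = (\<Prod>i<n. x (Suc i) ^ (r + \<tau> i)) *
      (\<Prod>j<m. y (Suc j) ^ (s + \<rho> j)) * row_det q n m l x y"
    for \<tau> \<rho> :: "nat \<Rightarrow> nat" and x y
  let ?S = "\<lambda>n. {p. p permutes {0..<n :: nat}}"
  have expand: "row_det_const q n m l * g x y =
      (\<Sum>\<tau>\<in>?S n. \<Sum>\<rho>\<in>?S m. (signof \<tau> * signof \<rho>) * t \<tau> \<rho> x y)"
    if "\<And>i. x i \<noteq> 0" for x y
  proof -
    let ?dx = "\<Prod>j<n. \<Prod>i<j. x (Suc j) - x (Suc i)"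
    let ?dy = "\<Prod>j<m. \<Prod>i<j. y (Suc j) - y (Suc i)"
    have "row_det_const q n m l * g x y =
        (\<Prod>i=1..n. x i ^ r) * (\<Prod>j=1..m. y j ^ s) * ?dx * ?dy * row_det q n m l x y"
      unfolding row_det_eq[OF that] g_def prod_pairs_from_1 power2_eq_square prod.distrib
      by (simp only: mult_ac)
    also have "\<dots> = (\<Prod>i<n. x (Suc i) ^ r) * (\<Prod>j<m. y (Suc j) ^ s) * ?dx * ?dy *
        row_det q n m l x y"
      by (simp add: prod.atLeast1_atMost_eq)
    also have "\<dots> = (\<Sum>\<tau>\<in>?S n. \<Sum>\<rho>\<in>?S m. (signof \<tau> * signof \<rho>) * t \<tau> \<rho> x y)"
      unfolding prod_diff_leibniz t_def power_add prod.distrib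
      by (simp add: sum_product sum_distrib_left sum_distrib_right mult_ac)
    finally show ?thesis .
  qed
  have term_sum: "((\<lambda>(k, k'). t \<tau> \<rho> (\<lambda>i. q ^ k i) (\<lambda>j. q ^ k' j) * w k k') has_sum
      signof \<tau> * signof \<rho> * moment_det q n m l r s) ?X"
    if "\<tau> permutes {0..<n}" "\<rho> permutes {0..<m}" for \<tau> \<rho>
    using has_sum_monomial_row_det[OF q, where n = n and m = m and l = l
      and e = "\<lambda>i. r + \<tau> i" and f = "\<lambda>j. s + \<rho> j"]
    unfolding t_def w_def moment_det_def
    by (subst (asm) det_permute_block_rows[OF that,
        where A = "\<lambda>i p. 1 / (1 - q ^ (r + i + (n + m + l) - p))"
        and B = "\<lambda>j p. (q ^ (l + 1)) ^ p / (1 - q ^ (s + j + p + 1))"])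
  have sgn: "real_of_int (sign p) * real_of_int (sign p) = 1" for p :: "nat \<Rightarrow> nat"
    by (simp add: sign_def)
  have "((\<lambda>z. \<Sum>\<tau>\<in>?S n. \<Sum>\<rho>\<in>?S m. (signof \<tau> * signof \<rho>) *
      (case z of (k, k') \<Rightarrow> t \<tau> \<rho> (\<lambda>i. q ^ k i) (\<lambda>j. q ^ k' j) * w k k')) has_sum
      (\<Sum>\<tau>\<in>?S n. \<Sum>\<rho>\<in>?S m. (signof \<tau> * signof \<rho>) *
        (signof \<tau> * signof \<rho> * moment_det q n m l r s))) ?X"
    by (intro has_sum_sum has_sum_cmult_right term_sum) auto
  also have "(\<Sum>\<tau>\<in>?S n. \<Sum>\<rho>\<in>?S m. (signof \<tau> * signof \<rho>) *
        (signof \<tau> * signof \<rho> * moment_det q n m l r s)) =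
      (\<Sum>\<tau>\<in>?S n. \<Sum>\<rho>\<in>?S m. (signof \<tau> * signof \<tau>) * (signof \<rho> * signof \<rho>) *
        moment_det q n m l r s)"
    by (simp only: mult_ac)
  also have "\<dots> = fact n * fact m * moment_det q n m l r s"
    by (simp only: sgn) (simp add: card_permutations)
  also have "(\<lambda>z. \<Sum>\<tau>\<in>?S n. \<Sum>\<rho>\<in>?S m. (signof \<tau> * signof \<rho>) *
      (case z of (k, k') \<Rightarrow> t \<tau> \<rho> (\<lambda>i. q ^ k i) (\<lambda>j. q ^ k' j) * w k k')) =
    (\<lambda>z. row_det_const q n m l *
      (case z of (k, k') \<Rightarrow> g (\<lambda>i. q ^ k i) (\<lambda>j. q ^ k' j) * w k k'))"
  proof (intro ext, clarify)
    fix k k' :: "nat \<Rightarrow> nat"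
    show "(\<Sum>\<tau>\<in>?S n. \<Sum>\<rho>\<in>?S m. (signof \<tau> * signof \<rho>) *
        (t \<tau> \<rho> (\<lambda>i. q ^ k i) (\<lambda>j. q ^ k' j) * w k k')) =
      row_det_const q n m l * (g (\<lambda>i. q ^ k i) (\<lambda>j. q ^ k' j) * w k k')"
      using expand[of "\<lambda>i. q ^ k i" "\<lambda>j. q ^ k' j"] q
      by (simp add: mult.assoc[symmetric] sum_distrib_right[symmetric])
  qed
  finally have "infsum (\<lambda>z. row_det_const q n m l *
      (case z of (k, k') \<Rightarrow> g (\<lambda>i. q ^ k i) (\<lambda>j. q ^ k' j) * w k k')) ?X =
      fact n * fact m * moment_det q n m l r s"
    by (rule infsumI)
  then have "jackson_integral q n m g * row_det_const q n m l =
      (1 - q) ^ (n + m) * fact n * fact m * moment_det q n m l r s"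
    unfolding jackson_integral_def w_def infsum_cmult_right' by (simp add: mult_ac)
  then show ?thesis
    unfolding g_def .
qed

lemma abs_moment_det:
  fixes n m l r s :: nat
  assumes q: "0 < q" "q < 1"
  defines "N \<equiv> n + m + l"
  shows "\<bar>moment_det q n m l r s\<bar> = (\<Prod>p<N. q ^ p) *
    (\<Prod>j<n. \<Prod>i<j. \<bar>q ^ (r + N + j) - q ^ (r + N + i)\<bar>) *
    (\<Prod>i<n. \<Prod>j<m. 1 - q ^ (N + r + s + i + j + 1)) *
    (\<Prod>j<m. \<Prod>i<j. \<bar>q ^ (s + 1 + j) - q ^ (s + 1 + i)\<bar>) *
    (\<Prod>j<N. \<Prod>i<j. \<bar>q ^ j - q ^ i\<bar>) /
    ((\<Prod>i<n. \<Prod>p<N. q ^ p - q ^ (r + i + N)) * (\<Prod>j<m. \<Prod>p<N. 1 - q ^ (s + j + p + 1)))"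
proof -
  \<comment> \<open>After a factor \<open>q ^ p\<close> is taken out of column \<open>p\<close>, the
    matrix has Cauchy-Vandermonde form at the points \<open>q ^ p\<close> with these data;
    \<open>\<sigma>\<close> records the sign from writing \<open>1 - b v\<close> as
    \<open>-(b v - 1)\<close> in the second block.\<close>
  define a where "a i = (if i < n then q ^ (r + i + N) else 1)" for i
  define b where "b i = (if i < n then 1 else q ^ (s + (i - n) + 1))" for i
  define e where "e i = (if i < n then 0 else l)" for i
  define \<sigma> :: "nat \<Rightarrow> real" where "\<sigma> i = (if i < n then 1 else if i < n + m then -1 else 1)" for i
  have less: "q ^ u < q ^ v" if "v < u" for u v :: nat
    using q that by (simp add: power_strict_decreasing)
  have less1: "q ^ u < 1" if "0 < u" for u :: nat
    using less[OF that] by simp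
  have inj: "q ^ u = q ^ v \<longleftrightarrow> u = v" for u v :: nat
    using less[of u v] less[of v u] by (cases u v rule: linorder_cases) auto
  have den: "b i * q ^ p - a i = (if i < n then q ^ p - q ^ (r + i + N)
      else - (1 - q ^ (s + (i - n) + p + 1)))" for i p
  proof -
    have "q ^ (s + (i - n) + 1) * q ^ p = q ^ (s + (i - n) + p + 1)"
      by (simp only: power_add mult_ac)
    then show ?thesis
      by (cases "i < n") (simp_all only: a_def b_def if_True if_False minus_diff_eq mult_1_left)
  qed
  have nz: "b i * q ^ p \<noteq> a i" if "p < N" for i p
  proof -
    have "b i * q ^ p - a i \<noteq> 0"
      unfolding den using that less1[of "s + (i - n) + p + 1"] by (auto simp: inj)
    then show ?thesis by simp
  qed
  have "moment_det q n m l r s = det (mat N N (\<lambda>(i, p). q ^ p * (\<sigma> i *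
      (if i < n + m then (q ^ p) ^ e i / (b i * q ^ p - a i) else (q ^ p) ^ (i - (n + m))))))"
    unfolding moment_det_def N_def[symmetric]
  proof (rule det_mat_cong)
    fix i p assume ip: "i < N" "p < N"
    have 1: "1 / (1 - q ^ (r + i + N - p)) = q ^ p / (q ^ p - q ^ (r + i + N))"
    proof -
      have "q ^ (r + i + N) = q ^ p * q ^ (r + i + N - p)"
        using ip by (simp add: power_add[symmetric])
      then have "q ^ p - q ^ (r + i + N) = q ^ p * (1 - q ^ (r + i + N - p))"
        by (simp add: algebra_simps)
      then show ?thesis using q by simp
    qed
    have 2: "(q ^ u) ^ p = (q ^ p) ^ u" for u
      by (simp add: power_mult[symmetric] mult.commute)
    show "(if i < n then 1 / (1 - q ^ (r + i + N - p))
      else if i < n + m then (q ^ (l + 1)) ^ p / (1 - q ^ (s + (i - n) + p + 1))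
      else (q ^ Suc (i - n - m)) ^ p) = q ^ p * (\<sigma> i *
      (if i < n + m then (q ^ p) ^ e i / (b i * q ^ p - a i) else (q ^ p) ^ (i - (n + m))))"
      unfolding den 1 2 by (simp add: \<sigma>_def e_def del: minus_diff_eq)
  qed
  also have "\<dots> = (\<Prod>p<N. q ^ p) * ((\<Prod>i<N. \<sigma> i) * det (mat N N (\<lambda>(i, p).
      if i < n + m then (q ^ p) ^ e i / (b i * q ^ p - a i) else (q ^ p) ^ (i - (n + m)))))"
    by (simp only: det_mat_scale_rows det_mat_scale_cols)
  also have "det (mat N N (\<lambda>(i, p).
      if i < n + m then (q ^ p) ^ e i / (b i * q ^ p - a i) else (q ^ p) ^ (i - (n + m)))) =
    (\<Prod>i<n + m. a i ^ e i * b i ^ (l - e i)) * (\<Prod>j<n + m. \<Prod>i<j. a i * b j - a j * b i) *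
    (\<Prod>j<N. \<Prod>i<j. q ^ j - q ^ i) / (\<Prod>p<N. \<Prod>i<n + m. b i * q ^ p - a i)"
    unfolding N_def
  proof (rule det_cauchy_vandermonde)
    show "b i \<noteq> 0" for i using q by (simp add: b_def)
    show "e i \<le> l" for i by (simp add: e_def)
    show "b i * q ^ p \<noteq> a i" if "p < n + m + l" for i p
      using nz that by (simp add: N_def)
    show "a i * b j \<noteq> a j * b i" if "i < j" "j < n + m" for i j
    proof -
      \<comment> \<open>This settles pairs with one index in each block; within a block the
        exponents themselves differ.\<close>
      have "q ^ (r + i + N) * q ^ (s + (j - n) + 1) \<noteq> 1"
        unfolding power_add[symmetric] using less1[of "r + i + N + (s + (j - n) + 1)"] by simp
      then show ?thesis
        using that by (auto simp: a_def b_def inj simp del: power_Suc)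
    qed
  qed
  \<comment> \<open>In the first block \<open>e i = 0\<close> and \<open>b i = 1\<close>; in the
    second \<open>e i = l\<close> and \<open>a i = 1\<close>.\<close>
  also have "(\<Prod>i<n + m. a i ^ e i * b i ^ (l - e i)) = 1"
    by (rule prod.neutral) (auto simp: a_def b_def e_def)
  finally have "\<bar>moment_det q n m l r s\<bar> = (\<Prod>p<N. q ^ p) * (\<Prod>i<N. \<bar>\<sigma> i\<bar>) *
    ((\<Prod>j<n + m. \<Prod>i<j. \<bar>a i * b j - a j * b i\<bar>) *
    (\<Prod>j<N. \<Prod>i<j. \<bar>q ^ j - q ^ i\<bar>) / (\<Prod>p<N. \<Prod>i<n + m. \<bar>b i * q ^ p - a i\<bar>))"
    using q by (simp add: abs_mult abs_prod)
  also have "(\<Prod>i<N. \<bar>\<sigma> i\<bar>) = 1"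
    by (rule prod.neutral) (auto simp: \<sigma>_def)
  also have "(\<Prod>p<N. \<Prod>i<n + m. \<bar>b i * q ^ p - a i\<bar>) =
    (\<Prod>i<n. \<Prod>p<N. \<bar>b i * q ^ p - a i\<bar>) * (\<Prod>j<m. \<Prod>p<N. \<bar>b (n + j) * q ^ p - a (n + j)\<bar>)"
    by (subst prod.swap) (simp only: prod_lessThan_add)
  also have "(\<Prod>i<n. \<Prod>p<N. \<bar>b i * q ^ p - a i\<bar>) = (\<Prod>i<n. \<Prod>p<N. q ^ p - q ^ (r + i + N))"
    unfolding den
  proof (intro prod.cong refl)
    fix i p assume "i \<in> {..<n}" "p \<in> {..<N}"
    then show "\<bar>if i < n then q ^ p - q ^ (r + i + N) else - (1 - q ^ (s + (i - n) + p + 1))\<bar> =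
        q ^ p - q ^ (r + i + N)"
      using less[of p "r + i + N"] by simp
  qed
  also have "(\<Prod>j<m. \<Prod>p<N. \<bar>b (n + j) * q ^ p - a (n + j)\<bar>) =
    (\<Prod>j<m. \<Prod>p<N. 1 - q ^ (s + j + p + 1))"
    unfolding den
  proof (intro prod.cong refl)
    fix j p
    show "\<bar>if n + j < n then q ^ p - q ^ (r + (n + j) + N) else - (1 - q ^ (s + (n + j - n) + p + 1))\<bar> =
        1 - q ^ (s + j + p + 1)"
      using less1[of "s + j + p + 1"] by simp
  qed
  also have "(\<Prod>j<n + m. \<Prod>i<j. \<bar>a i * b j - a j * b i\<bar>) =
    (\<Prod>j<n. \<Prod>i<j. \<bar>q ^ (r + N + j) - q ^ (r + N + i)\<bar>) *
    (\<Prod>i<n. \<Prod>j<m. 1 - q ^ (N + r + s + i + j + 1)) *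
    (\<Prod>j<m. \<Prod>i<j. \<bar>q ^ (s + 1 + j) - q ^ (s + 1 + i)\<bar>)"
    unfolding prod_pairs_add
  proof (intro arg_cong2[where f = "(*)"] prod.cong refl)
    fix i j assume "i \<in> {..<n}" "j \<in> {..<m}"
    moreover have "q ^ (r + i + N) * q ^ (s + j + 1) = q ^ (N + r + s + i + j + 1)"
      by (simp only: power_add mult_ac)
    ultimately show "\<bar>a i * b (n + j) - a (n + j) * b i\<bar> = 1 - q ^ (N + r + s + i + j + 1)"
      using less1[of "N + r + s + i + j + 1"] by (simp add: a_def b_def del: power_Suc)
  qed (auto simp: a_def b_def add_ac abs_minus_commute)
  finally show ?thesis by (simp only: mult_ac mult_1_left times_divide_eq_right)
qed

section \<open>Evaluation\<close>

lemma prod_pairs_const: "(\<Prod>j<n. \<Prod>i<j. c) = (c :: 'a :: comm_monoid_mult) ^ (n choose 2)"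
  by (induction n) (auto simp: power_add numeral_2_eq_2 mult_ac)

lemma prod_power_index: "(\<Prod>i<n. c ^ i) = (c :: 'a :: comm_monoid_mult) ^ (n choose 2)"
  using prod_pairs_const[of c n] by simp

lemma one_minus_power_eq_bracket: "q < 1 \<Longrightarrow> 1 - q ^ a = (1 - q) * q_bracket q a"
  by (simp add: q_bracket_def)

lemma q_bracket_pos:
  assumes "0 < q" "q < 1" "0 < a"
  shows "0 < q_bracket q a"
  using assms by (simp add: q_bracket_def power_less_one_iff)

lemma q_fact_pos: "0 < q \<Longrightarrow> q < 1 \<Longrightarrow> 0 < q_fact q k"
  unfolding q_fact_def by (intro prod_pos) (simp add: q_bracket_pos)

text \<open>For \<open>i < j\<close> the absolute difference is \<open>q ^ (d + i) * (1 - q)\<close>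
  times the bracket of \<open>j - i\<close>. At fixed \<open>j\<close> the brackets multiply to
  \<open>q_fact q j\<close> and the powers \<open>q ^ i\<close> to exponent
  \<open>j choose 2\<close>; these exponents add up to \<open>n choose 3\<close>.\<close>

lemma prod_pairs_power_diff:
  assumes q: "0 < q" "q < 1"
  shows "(\<Prod>j<n. \<Prod>i<j. \<bar>q ^ (d + j) - q ^ (d + i)\<bar>) =
    q ^ (d * (n choose 2) + (n choose 3)) * (1 - q) ^ (n choose 2) * (\<Prod>k=1..n-1. q_fact q k)"
proof -
  have base: "(\<Prod>j<n. \<Prod>i<j. \<bar>q ^ j - q ^ i\<bar>) =
    q ^ (n choose 3) * (1 - q) ^ (n choose 2) * (\<Prod>k<n. q_fact q k)"
  proof (induction n)
    case (Suc n)
    have "(\<Prod>i<n. \<bar>q ^ n - q ^ i\<bar>) = (\<Prod>i<n. q ^ i * ((1 - q) * q_bracket q (Suc (n - Suc i))))"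
    proof (rule prod.cong[OF refl])
      fix i assume "i \<in> {..<n}"
      then have i: "Suc (n - Suc i) = n - i" "i < n" by auto
      have "q ^ n = q ^ i * q ^ (n - i)"
        using i by (simp add: power_add[symmetric])
      then have "q ^ n - q ^ i = - (q ^ i * (1 - q ^ (n - i)))"
        by (simp add: algebra_simps)
      moreover have "q ^ (n - i) \<le> 1"
        using q by (simp add: power_le_one)
      ultimately show "\<bar>q ^ n - q ^ i\<bar> = q ^ i * ((1 - q) * q_bracket q (Suc (n - Suc i)))"
        using q i by (simp add: abs_mult one_minus_power_eq_bracket[symmetric])
    qed
    also have "\<dots> = q ^ (n choose 2) * (1 - q) ^ n * (\<Prod>i<n. q_bracket q (Suc (n - Suc i)))"
      by (simp add: prod.distrib prod_power_index)
    also have "(\<Prod>i<n. q_bracket q (Suc (n - Suc i))) = (\<Prod>i<n. q_bracket q (Suc i))"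
      by (rule prod.nat_diff_reindex)
    also have "\<dots> = q_fact q n"
      by (simp add: q_fact_def prod.atLeast1_atMost_eq)
    finally show ?case
      using Suc by (simp add: power_add numeral_3_eq_3 numeral_2_eq_2 mult_ac)
  qed (simp add: numeral_3_eq_3 numeral_2_eq_2)
  \<comment> \<open>The term at \<open>k = 0\<close> is an empty product, equal to 1. For
    \<open>n = 0\<close> both sides are empty, since \<open>n - 1\<close> truncates to 0.\<close>
  have "(\<Prod>k<n. q_fact q k) = (\<Prod>k=1..n-1. q_fact q k)"
  proof (cases n)
    case (Suc k)
    have "(\<Prod>k<Suc k. q_fact q k) = q_fact q 0 * (\<Prod>i<k. q_fact q (Suc i))"
      by (rule prod.lessThan_Suc_shift)
    then show ?thesis
      using Suc by (simp add: q_fact_def[of q 0] prod.atLeast1_atMost_eq)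
  qed simp
  moreover have "(\<Prod>j<n. \<Prod>i<j. \<bar>q ^ (d + j) - q ^ (d + i)\<bar>) =
    (\<Prod>j<n. \<Prod>i<j. q ^ d * \<bar>q ^ j - q ^ i\<bar>)"
    using q by (simp add: power_add right_diff_distrib[symmetric] abs_mult)
  ultimately show ?thesis
    unfolding power_add power_mult by (simp only: prod.distrib prod_pairs_const base mult_ac)
qed

section \<open>Bookkeeping of exponents and the final comparison\<close>

lemma real_choose_two: "real (n choose 2) = real n * (real n - 1) / 2"
  by (induction n) (auto simp: numeral_2_eq_2 field_simps)

lemma real_choose_three: "real (n choose 3) = real n * (real n - 1) * (real n - 2) / 6"
proof (induction n)
  case (Suc n)
  have "real (Suc n choose 3) = real (n choose 2) + real (n choose 3)"
    by (simp add: numeral_3_eq_3 numeral_2_eq_2)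
  then show ?case
    unfolding Suc real_choose_two by (simp add: field_simps)
qed simp

text \<open>Powers of \<open>q\<close> in the final comparison. On the left: the claimed value,
  \<open>row_det_const\<close>, and the denominator of \<open>moment_det\<close>; on the right: the
  numerator of \<open>moment_det\<close>. Over the reals it is a polynomial identity.\<close>

lemma q_exponent_identity:
  assumes "N = n + m + l"
  shows "((r + 1) * (n choose 2) + (s + 1) * (m choose 2) + 2 * (n choose 3) + 2 * (m choose 3)) +
      ((l + 1) * (m choose 2) + (Suc l choose 2) * m + (l choose 2) + (l choose 3)) + (N choose 2) * n =
    (N choose 2) + ((r + N) * (n choose 2) + (n choose 3)) + ((s + 1) * (m choose 2) + (m choose 3)) +
      (N choose 3)"
proof -
  have "real (((r + 1) * (n choose 2) + (s + 1) * (m choose 2) + 2 * (n choose 3) + 2 * (m choose 3)) +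
      ((l + 1) * (m choose 2) + (Suc l choose 2) * m + (l choose 2) + (l choose 3)) + (N choose 2) * n) =
    real ((N choose 2) + ((r + N) * (n choose 2) + (n choose 3)) +
      ((s + 1) * (m choose 2) + (m choose 3)) + (N choose 3))"
    unfolding of_nat_add of_nat_mult real_choose_two real_choose_three assms
    by (simp add: field_simps)
  then show ?thesis by (simp only: of_nat_eq_iff)
qed

text \<open>The same count for powers of \<open>1 - q\<close>; the summand \<open>n + m\<close> is
  the prefactor of the Jackson integral.\<close>

lemma one_minus_q_exponent_identity:
  assumes "N = n + m + l"
  shows "(l choose 2) + (N * n + N * m) =
    (n + m) + ((n choose 2) + m * n + (m choose 2) + (N choose 2))"
proof -
  have "real ((l choose 2) + (N * n + N * m)) =
    real ((n + m) + ((n choose 2) + m * n + (m choose 2) + (N choose 2)))"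
    unfolding of_nat_add of_nat_mult real_choose_two assms by (simp add: field_simps)
  then show ?thesis by (simp only: of_nat_eq_iff)
qed

lemma abs_row_det_const:
  assumes q: "0 < q" "q < 1"
  shows "\<bar>row_det_const q n m l\<bar> =
    q ^ ((l + 1) * (m choose 2) + (Suc l choose 2) * m + (l choose 2) + (l choose 3)) *
    (1 - q) ^ (l choose 2) * (\<Prod>k=1..l-1. q_fact q k)"
proof -
  have "\<bar>row_det_const q n m l\<bar> = (\<Prod>j<m. \<Prod>i<j. q ^ (l + 1)) * (\<Prod>k<Suc l. q ^ k) ^ m *
     (\<Prod>j<l. \<Prod>i<j. \<bar>q ^ (1 + j) - q ^ (1 + i)\<bar>)"
    \<comment> \<open>Adding the factor \<open>q ^ 0 = 1\<close> turns the product of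
      \<open>q ^ Suc k\<close> into one over \<open>k < Suc l\<close>, whose exponent is
      \<open>Suc l choose 2\<close>.\<close>
    unfolding row_det_const_def prod.lessThan_Suc_shift
    using q by (simp add: abs_mult abs_prod power_abs)
  then show ?thesis
    unfolding prod_pairs_const prod_power_index prod_pairs_power_diff[OF q]
    unfolding power_add power_mult by (simp only: power_one_right mult_ac)
qed

theorem theorem5p3:
  fixes n m l N r s :: nat and q :: real
  assumes "N = n + m + l" and "N > 0" and "0 < q" and "q < 1"
  shows "jackson_integral q n m (\<lambda>x y.
           (\<Prod>i=1..n. x i ^ r * q_poch_shifted q (x i) l) *
           (\<Prod>j=1..m. y j ^ s * q_poch_shifted q (y j) l) *
           (\<Prod>i=1..n. \<Prod>j=1..m. (1 - q ^ (l + 1) * x i * y j)) *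
           (\<Prod>i=1..n. \<Prod>j=i+1..n. (x j - x i)\<^sup>2) *
           (\<Prod>i=1..m. \<Prod>j=i+1..m. (y j - y i)\<^sup>2))
       = fact n * fact m *
         q ^ ((r + 1) * (n choose 2) + (s + 1) * (m choose 2) + 2 * (n choose 3) + 2 * (m choose 3)) *
         (((\<Prod>k=1..N-1. q_fact q k) * (\<Prod>k=1..n-1. q_fact q k) * (\<Prod>k=1..m-1. q_fact q k)) /
          (\<Prod>k=1..l-1. q_fact q k)) *
         ((\<Prod>i=1..n. \<Prod>j=1..m. q_bracket q (N + r + s + i + j - 1)) /
          ((\<Prod>i=1..n. \<Prod>k=1..N. q_bracket q (r + i + k - 1)) *
           (\<Prod>j=1..m. \<Prod>k=1..N. q_bracket q (s + j + k - 1))))"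
    (is "?I = _ * _ * q ^ ?E * _ * (?X / (?Y * ?Z))")
proof -
  note q = assms(3,4)
  let ?F = "\<lambda>n :: nat. \<Prod>k=1..n-1. q_fact q k"
  \<comment> \<open>All grid points lie in the interval from 0 to 1, so every factor of the summand
    is nonnegative. Hence the integral is determined by absolute values.\<close>
  have nonneg: "0 \<le> ?I"
    unfolding jackson_integral_def
  proof (intro mult_nonneg_nonneg infsum_nonneg)
    have le: "q ^ u * q ^ v \<le> 1" for u v
      using q by (simp add: power_add[symmetric] power_le_one)
    have "0 \<le> q_poch_shifted q (q ^ k) l" for k
      unfolding q_poch_shifted_def by (intro prod_nonneg) (simp add: le)
    moreover have "0 \<le> 1 - q ^ (l + 1) * q ^ i * q ^ j" for i j
      using q by (simp add: power_add[symmetric] power_le_one del: power_Suc)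
    ultimately show "0 \<le> (case z of (k, k') \<Rightarrow>
        (\<Prod>i=1..n. (q ^ k i) ^ r * q_poch_shifted q (q ^ k i) l) *
        (\<Prod>j=1..m. (q ^ k' j) ^ s * q_poch_shifted q (q ^ k' j) l) *
        (\<Prod>i=1..n. \<Prod>j=1..m. (1 - q ^ (l + 1) * q ^ k i * q ^ k' j)) *
        (\<Prod>i=1..n. \<Prod>j=i+1..n. (q ^ k j - q ^ k i)\<^sup>2) *
        (\<Prod>i=1..m. \<Prod>j=i+1..m. (q ^ k' j - q ^ k' i)\<^sup>2) *
        q ^ ((\<Sum>i=1..n. k i) + (\<Sum>j=1..m. k' j)))" for z :: "(nat \<Rightarrow> nat) \<times> (nat \<Rightarrow> nat)"
      using q by (cases z) (auto intro!: mult_nonneg_nonneg prod_nonneg)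
  qed (use q in auto)
  have abs_eq: "A * \<bar>k\<bar> = C * \<bar>D\<bar>" if "A * k = C * D" "0 \<le> A" "0 \<le> C" for A k C D :: real
    using that by (metis abs_mult abs_of_nonneg)
  have I: "?I * \<bar>row_det_const q n m l\<bar> =
      (1 - q) ^ (n + m) * fact n * fact m * \<bar>moment_det q n m l r s\<bar>"
    by (rule abs_eq[OF jackson_integral_eq_moment_det[OF q] nonneg]) (use q in simp)
  have X: "(\<Prod>i<n. \<Prod>j<m. 1 - q ^ (N + r + s + i + j + 1)) = (1 - q) ^ (m * n) * ?X"
    unfolding one_minus_power_eq_bracket[OF q(2)]
    by (simp add: prod.distrib prod.atLeast1_atMost_eq power_mult)
  have Z: "(\<Prod>j<m. \<Prod>p<N. 1 - q ^ (s + j + p + 1)) = (1 - q) ^ (N * m) * ?Z"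
    unfolding one_minus_power_eq_bracket[OF q(2)]
    by (simp add: prod.distrib prod.atLeast1_atMost_eq power_mult)
  \<comment> \<open>Here \<open>q ^ p\<close> is factored out and \<open>p\<close> reversed, so that
    \<open>N - p\<close> runs through \<open>1..N\<close>; with \<open>i\<close> counted from 0 this
    gives the brackets of \<open>r + i + p + 1\<close>.\<close>
  have Y: "(\<Prod>i<n. \<Prod>p<N. q ^ p - q ^ (r + i + N)) = q ^ ((N choose 2) * n) * (1 - q) ^ (N * n) * ?Y"
  proof -
    have "(\<Prod>p<N. q ^ p - q ^ (r + i + N)) =
      q ^ (N choose 2) * (1 - q) ^ N * (\<Prod>p<N. q_bracket q (r + i + p + 1))" for i
    proof -
      have "(\<Prod>p<N. q ^ p - q ^ (r + i + N)) =
        (\<Prod>p<N. q ^ p * ((1 - q) * q_bracket q (r + i + (N - Suc p) + 1)))"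
      proof (rule prod.cong[OF refl])
        fix p assume "p \<in> {..<N}"
        then have "r + i + N = p + (r + i + (N - Suc p) + 1)" by simp
        then have "q ^ (r + i + N) = q ^ p * q ^ (r + i + (N - Suc p) + 1)"
          by (metis power_add)
        then show "q ^ p - q ^ (r + i + N) = q ^ p * ((1 - q) * q_bracket q (r + i + (N - Suc p) + 1))"
          using q by (simp add: one_minus_power_eq_bracket[symmetric] right_diff_distrib del: power_Suc)
      qed
      also have "\<dots> = q ^ (N choose 2) * (1 - q) ^ N * (\<Prod>p<N. q_bracket q (r + i + (N - Suc p) + 1))"
        by (simp add: prod.distrib prod_power_index)
      also have "(\<Prod>p<N. q_bracket q (r + i + (N - Suc p) + 1)) = (\<Prod>p<N. q_bracket q (r + i + p + 1))"
        by (rule prod.nat_diff_reindex)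
      finally show ?thesis .
    qed
    then show ?thesis
      by (simp add: prod.distrib prod.atLeast1_atMost_eq power_mult power_mult_distrib)
  qed
  have pos: "?Y > 0" "?Z > 0" "?F l > 0" "0 < 1 - q"
    using q by (auto intro!: prod_pos q_bracket_pos q_fact_pos)
  let ?e = "(l + 1) * (m choose 2) + (Suc l choose 2) * m + (l choose 2) + (l choose 3)"
  have V: "(\<Prod>j<N. \<Prod>i<j. \<bar>q ^ j - q ^ i\<bar>) = q ^ (N choose 3) * (1 - q) ^ (N choose 2) * ?F N"
    using prod_pairs_power_diff[OF q, of 0 N] by simp
  have D: "\<bar>moment_det q n m l r s\<bar> =
    q ^ ((N choose 2) + ((r + N) * (n choose 2) + (n choose 3)) +
      ((s + 1) * (m choose 2) + (m choose 3)) + (N choose 3)) *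
    (1 - q) ^ ((n choose 2) + m * n + (m choose 2) + (N choose 2)) * (?F N * ?F n * ?F m * ?X) /
    (q ^ ((N choose 2) * n) * (1 - q) ^ (N * n + N * m) * (?Y * ?Z))"
    unfolding abs_moment_det[OF q, of n m l r s, folded assms(1)] X Y Z V
      prod_power_index prod_pairs_power_diff[OF q]
    unfolding power_add by (simp only: mult_ac)
  let ?R = "fact n * fact m * q ^ ?E * ((?F N * ?F n * ?F m) / ?F l) * (?X / (?Y * ?Z))"
  \<comment> \<open>This isolates the rational rearrangement: the powers of \<open>q\<close> and of
    \<open>1 - q\<close> enter only through the first two conditions, which are the two exponent
    identities.\<close>
  have combine: "f1 * f2 * E * (F / Fl) * (X / W) * (e * z1 * Fl) =
      z0 * f1 * f2 * (A2 * z3 * (F * X) / (A1 * z2 * W))"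
    if "E * e * A1 = A2" "z1 * z2 = z0 * z3" "Fl \<noteq> 0" "W \<noteq> 0" "A1 \<noteq> 0" "z2 \<noteq> 0"
    for f1 f2 E F Fl X W e z0 z1 z2 z3 A1 A2 :: real
  proof -
    have "z1 = z0 * z3 / z2" using that by (simp add: field_simps)
    then show ?thesis using that by (simp add: that(1)[symmetric] mult_ac)
  qed
  have "?R * \<bar>row_det_const q n m l\<bar> =
      (1 - q) ^ (n + m) * fact n * fact m * \<bar>moment_det q n m l r s\<bar>"
    unfolding abs_row_det_const[OF q] D
  proof (rule combine)
    show "q ^ ?E * q ^ ?e * q ^ ((N choose 2) * n) =
      q ^ ((N choose 2) + ((r + N) * (n choose 2) + (n choose 3)) +
        ((s + 1) * (m choose 2) + (m choose 3)) + (N choose 3))"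
      by (simp only: power_add[symmetric] q_exponent_identity[OF assms(1)])
    show "(1 - q) ^ (l choose 2) * (1 - q) ^ (N * n + N * m) =
      (1 - q) ^ (n + m) * (1 - q) ^ ((n choose 2) + m * n + (m choose 2) + (N choose 2))"
      by (simp only: power_add[symmetric] one_minus_q_exponent_identity[OF assms(1)])
    show "?F l \<noteq> 0"
      by (rule less_imp_neq[OF pos(3), symmetric])
    show "?Y * ?Z \<noteq> 0"
      by (rule less_imp_neq[OF mult_pos_pos[OF pos(1,2)], symmetric])
  qed (use q in auto)
  with I have "?I * \<bar>row_det_const q n m l\<bar> = ?R * \<bar>row_det_const q n m l\<bar>"
    by (simp only:)
  moreover have "\<bar>row_det_const q n m l\<bar> > 0"
    unfolding abs_row_det_const[OF q] using pos q by (intro mult_pos_pos zero_less_power)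
  ultimately show ?thesis
    by (metis (no_types, lifting) mult_right_cancel less_irrefl)
qed

end
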